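(* Let $s\ge1$ and $n\ge1$ be integers, let $p,q\in(0,1)$ satisfy $\sum_{k=0}^{s}p^kq^{s-k}=1$, let $X\sim\mathcal{B}^{(s)}(n,p)$ follow the bi$^s$nomial distribution, and let $x_i=\sum_{l=1}^{s}l^ip^lq^{s-l}$ for $i\ge1$. Then for every integer $r\geq1$ the $r$-th cumulant $\kappa_r(X)$ satisfies $$\kappa_r(X)=n\sum_{k=1}^{r}(-1)^{k-1}(k-1)!\,B_{r,k}\big(x_1,x_2,\ldots,x_{r-k+1}\big)\quad\text{if }p\neq q,$$ and $$\kappa_r(X)=n\sum_{k=1}^{r}(-1)^{k-1}(k-1)!\,p^{ks}\,B_{r,k}\Big(\sum_{l=1}^{s}l,\ \sum_{l=1}^{s}l^2,\ \ldots,\ \sum_{l=1}^{s}l^{r-k+1}\Big)\quad\text{if }p=q.$$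
   Context: For integers $n\ge 1$, $s\ge1$, $k\ge0$, the bi$^s$nomial coefficient $\binom{n}{k}_s$ is the number of integer solutions $(y_1,\dots,y_n)$ of $y_1+\cdots+y_n=k$ with $0\le y_i\le s$ for all $i$; equivalently, the coefficient of $x^k$ in $(1+x+\cdots+x^s)^n$. The bi$^s$nomial distribution $\mathcal{B}^{(s)}(n,p)$, where $p,q\in(0,1)$ satisfy $\sum_{k=0}^s p^kq^{s-k}=1$, is the law on $\{0,\dots,sn\}$ with $\mathbb{P}(X=k)=\binom{n}{k}_s p^kq^{sn-k}$. The cumulants are $\kappa_r(X)=K_X^{(r)}(0)$, where $K_X(t)=\ln E(e^{tX})$. The partial Bell polynomials are $$B_{r,k}(x_1,x_2,\ldots,x_{r-k+1})=\sum\frac{r!}{j_1!j_2!\cdots}\Big(\frac{x_1}{1!}\Big)^{j_1}\Big(\frac{x_2}{2!}\Big)^{j_2}\cdots,$$ the sum being over nonnegative integers $j_1,j_2,\ldots$ with $j_1+j_2+\cdots=k$ and $j_1+2j_2+3j_3+\cdots=r$; equivalently $\sum_{r\ge k}B_{r,k}(x_1,x_2,\ldots)\frac{t^r}{r!}=\frac1{k!}\big(\sum_{m\ge1}x_m\frac{t^m}{m!}\big)^k$. *)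

theory Defs
  imports "HOL-Probability.Probability"
begin

text \<open>\<open>bisnomial s n k\<close> is \<open>(n choose k)_s\<close>; a solution \<open>(y_1, \<dots>, y_n)\<close> is an extensional
  function on \<open>{1..n}\<close>.\<close>

definition bisnomial :: "nat \<Rightarrow> nat \<Rightarrow> nat \<Rightarrow> nat" where
  "bisnomial s n k = card {y \<in> {1..n} \<rightarrow>\<^sub>E {0..s}. (\<Sum>i=1..n. y i) = k}"

lemma bisnomial_eq_0: "s * n < k \<Longrightarrow> bisnomial s n k = 0"
proof -
  assume k: "s * n < k"
  have "{y \<in> {1..n} \<rightarrow>\<^sub>E {0..s}. (\<Sum>i=1..n. y i) = k} = {}"
  proof (rule equals0I)
    fix y assume "y \<in> {y \<in> {1..n} \<rightarrow>\<^sub>E {0..s}. (\<Sum>i=1..n. y i) = k}"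
    then have y: "y \<in> {1..n} \<rightarrow>\<^sub>E {0..s}" and sum: "(\<Sum>i=1..n. y i) = k"
      by blast+
    have "y i \<le> s" if "i \<in> {1..n}" for i
      using PiE_mem[OF y that] by simp
    then have "(\<Sum>i=1..n. y i) \<le> (\<Sum>i=1..n. s)"
      by (rule sum_mono)
    also have "\<dots> = s * n"
      by (simp add: mult.commute)
    finally show False
      using k unfolding sum by linarith
  qed
  then show ?thesis
    by (simp only: bisnomial_def card.empty)
qed

text \<open>The truncated subtraction \<open>s * n - k\<close> is harmless: by \<open>bisnomial_eq_0\<close> the mass at
  every \<open>k > s * n\<close> is zero.\<close>

definition bisnomial_mass :: "nat \<Rightarrow> nat \<Rightarrow> real \<Rightarrow> real \<Rightarrow> nat \<Rightarrow> real" where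
  "bisnomial_mass s n p q k = real (bisnomial s n k) * p ^ k * q ^ (s * n - k)"

definition bisnomial_distributed ::
    "'a measure \<Rightarrow> ('a \<Rightarrow> nat) \<Rightarrow> nat \<Rightarrow> nat \<Rightarrow> real \<Rightarrow> real \<Rightarrow> bool" where
  "bisnomial_distributed M X s n p q \<longleftrightarrow>
     distributed M (count_space UNIV) X (\<lambda>k. ennreal (bisnomial_mass s n p q k))"

definition cumulant_gf :: "'a measure \<Rightarrow> ('a \<Rightarrow> real) \<Rightarrow> real \<Rightarrow> real" where
  "cumulant_gf M X t = ln (integral\<^sup>L M (\<lambda>\<omega>. exp (t * X \<omega>)))"

definition cumulant :: "'a measure \<Rightarrow> ('a \<Rightarrow> real) \<Rightarrow> nat \<Rightarrow> real" where
  "cumulant M X r = (deriv ^^ r) (cumulant_gf M X) 0"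

text \<open>Exponent sequences \<open>(j_1, j_2, \<dots>)\<close> are supported on \<open>{1..r - k + 1}\<close>, the indices of the
  arguments of \<open>B_{r,k}\<close>: the two sum conditions force \<open>j_i = 0\<close> for \<open>i > r - k + 1\<close> when
  \<open>k \<le> r\<close>, and have no solutions when \<open>k > r\<close>.\<close>

definition partial_bell :: "nat \<Rightarrow> nat \<Rightarrow> (nat \<Rightarrow> real) \<Rightarrow> real" where
  "partial_bell r k x =
     (\<Sum>j | (\<forall>i. i \<notin> {1..r - k + 1} \<longrightarrow> j i = 0) \<and>
           (\<Sum>i=1..r - k + 1. j i) = k \<and> (\<Sum>i=1..r - k + 1. i * j i) = r.
        fact r / (\<Prod>i=1..r - k + 1. fact (j i)) *
        (\<Prod>i=1..r - k + 1. (x i / fact i) ^ j i))"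

end

theory Submission
  imports Defs
begin

unbundle no vec_syntax and fps_syntax

text \<open>The generating function \<open>\<Sum>k (n choose k)_s p^k q^(s n - k) z^k\<close> factors as
  \<open>(\<Sum>l\<le>s. p^l q^(s - l) z^l)^n\<close>, so the cumulant generating function of \<open>X\<close> is \<open>n\<close> times
  the logarithm of \<open>\<phi> t = \<Sum>l\<le>s. p^l q^(s - l) e^(l t)\<close>. Here \<open>\<phi> 0 = 1\<close> and the higher
  derivatives of \<open>\<phi>\<close> at \<open>0\<close> are the \<open>x_i\<close>, so expanding \<open>ln (1 + u) = \<Sum>k (-1)^(k-1) u^k / k\<close>
  at \<open>u = \<phi> - 1\<close> gives the formula, the \<open>r\<close>-th coefficient of \<open>u^k / k!\<close> being
  \<open>B_{r,k} / r!\<close>. If \<open>p = q\<close>, all \<open>x_i\<close> carry the factor \<open>p^s\<close>, which comes out of \<open>B_{r,k}\<close>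
  as \<open>p^(k s)\<close> by homogeneity.\<close>

section \<open>Multinomial theorem for formal power series\<close>

lemma finite_compositions:
  fixes k :: nat
  assumes "finite I"
  shows "finite {j. (\<forall>i. i \<notin> I \<longrightarrow> j i = 0) \<and> sum j I = k}"
proof (rule finite_subset)
  show "finite {j. \<forall>i. (i \<in> I \<longrightarrow> j i \<in> {..k}) \<and> (i \<notin> I \<longrightarrow> j i = 0)}"
    by (rule finite_set_of_finite_funs) (use assms in auto)
  show "{j. (\<forall>i. i \<notin> I \<longrightarrow> j i = 0) \<and> sum j I = k}
      \<subseteq> {j. \<forall>i. (i \<in> I \<longrightarrow> j i \<in> {..k}) \<and> (i \<notin> I \<longrightarrow> j i = 0)}"
    using assms by (auto intro: member_le_sum)
qed

lemma fps_const_prod: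
  fixes f :: "'b \<Rightarrow> 'a :: comm_ring_1"
  shows "fps_const (\<Prod>a\<in>A. f a) = (\<Prod>a\<in>A. fps_const (f a))"
  by (induction A rule: infinite_finite_induct) (simp_all flip: fps_const_mult)

text \<open>Dividing by \<open>k!\<close> distributes the multinomial coefficient as one
  \<open>1 / j_i!\<close> per factor. Each summand is then a product over \<open>I\<close>, and the
  induction step is a single binomial expansion that splits off the exponent of the new
  index.\<close>

lemma fps_multinomial:
  fixes f :: "'b \<Rightarrow> 'a :: field_char_0 fps"
  assumes "finite I"
  shows "fps_const (1 / fact k) * (\<Sum>i\<in>I. f i) ^ k =
    (\<Sum>j | (\<forall>i. i \<notin> I \<longrightarrow> j i = 0) \<and> sum j I = k.
       \<Prod>i\<in>I. fps_const (1 / fact (j i)) * f i ^ j i)"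
  using assms
proof (induction I arbitrary: k rule: finite_induct)
  case empty
  have "{j :: 'b \<Rightarrow> nat. \<forall>i. j i = 0} = {\<lambda>_. 0}" by auto
  then show ?case by (cases k) simp_all
next
  case (insert a I)
  let ?J = "\<lambda>I k. {j. (\<forall>i. i \<notin> I \<longrightarrow> j i = (0::nat)) \<and> sum j I = k}"
  let ?t = "\<lambda>j i. fps_const (1 / fact (j i)) * f i ^ j i"
  let ?S = "\<Sum>i\<in>I. f i"
  have "fps_const (1 / fact k) * (\<Sum>i\<in>insert a I. f i) ^ k =
      (\<Sum>m\<le>k. fps_const (1 / fact k) * (of_nat (k choose m) * f a ^ m * ?S ^ (k - m)))"
    using insert.hyps by (simp add: binomial_ring sum_distrib_left)
  also have "\<dots> = (\<Sum>m\<le>k. fps_const (1 / fact m) * f a ^ m *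
      (fps_const (1 / fact (k - m)) * ?S ^ (k - m)))"
  proof (rule sum.cong[OF refl])
    fix m assume "m \<in> {..k}"
    then have "1 / fact k * of_nat (k choose m) = 1 / fact m * (1 / fact (k - m) :: 'a)"
      by (simp add: binomial_fact field_simps)
    then have eq: "fps_const (1 / fact k) * of_nat (k choose m) =
        fps_const (1 / fact m) * fps_const (1 / fact (k - m) :: 'a)"
      by (simp only: fps_of_nat[symmetric] fps_const_mult)
    have "fps_const (1 / fact k) * (of_nat (k choose m) * f a ^ m * ?S ^ (k - m)) =
        (fps_const (1 / fact k) * of_nat (k choose m)) * f a ^ m * ?S ^ (k - m)"
      by (simp only: mult.assoc)
    then show "fps_const (1 / fact k) * (of_nat (k choose m) * f a ^ m * ?S ^ (k - m)) =
        fps_const (1 / fact m) * f a ^ m * (fps_const (1 / fact (k - m)) * ?S ^ (k - m))"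
      unfolding eq by (simp only: mult_ac)
  qed
  also have "\<dots> = (\<Sum>m\<le>k. \<Sum>j\<in>?J I (k - m).
      fps_const (1 / fact m) * f a ^ m * (\<Prod>i\<in>I. ?t j i))"
    by (simp only: insert.IH sum_distrib_left)
  also have "\<dots> = (\<Sum>(m, j)\<in>Sigma {..k} (\<lambda>m. ?J I (k - m)).
      fps_const (1 / fact m) * f a ^ m * (\<Prod>i\<in>I. ?t j i))"
    by (rule sum.Sigma) (simp_all add: finite_compositions insert.hyps)
  \<comment> \<open>The pair \<open>(m, j)\<close> corresponds to \<open>j(a := m)\<close>. The
    inverse resets the value at \<open>a\<close> to \<open>0\<close>, because sequences in
    \<open>?J I\<close> vanish outside \<open>I\<close>.\<close>
  also have "\<dots> = (\<Sum>j\<in>?J (insert a I) k. \<Prod>i\<in>insert a I. ?t j i)"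
  proof (rule sum.reindex_bij_witness[where i = "\<lambda>j. (j a, j(a := 0))"
        and j = "\<lambda>(m, j). j(a := m)"])
    fix y assume y: "y \<in> Sigma {..k} (\<lambda>m. ?J I (k - m))"
    obtain m j where [simp]: "y = (m, j)" by (cases y)
    have upd: "sum (j(a := m)) I = sum j I" "prod (?t (j(a := m))) I = prod (?t j) I"
      using insert.hyps by (auto intro!: sum.cong prod.cong)
    show "((case y of (m, j) \<Rightarrow> j(a := m)) a, (case y of (m, j) \<Rightarrow> j(a := m))(a := 0)) = y"
      using y insert.hyps by auto
    show "(case y of (m, j) \<Rightarrow> j(a := m)) \<in> ?J (insert a I) k"
      using y insert.hyps upd by auto
    show "(\<Prod>i\<in>insert a I. ?t (case y of (m, j) \<Rightarrow> j(a := m)) i) =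
        (case y of (m, j) \<Rightarrow> fps_const (1 / fact m) * f a ^ m * (\<Prod>i\<in>I. ?t j i))"
      using insert.hyps upd by simp
  next
    fix j assume j: "j \<in> ?J (insert a I) k"
    have "sum (j(a := 0)) I = sum j I"
      using insert.hyps by (auto intro!: sum.cong)
    then show "(j a, j(a := 0)) \<in> Sigma {..k} (\<lambda>m. ?J I (k - m))"
      using j insert.hyps by auto
  qed auto
  finally show ?case .
qed

section \<open>Partial Bell polynomials as coefficients of powers of a series\<close>

lemma partial_bell_cong:
  assumes "\<And>i. i \<ge> 1 \<Longrightarrow> x i = y i"
  shows "partial_bell r k x = partial_bell r k y"
  unfolding partial_bell_def
  by (intro sum.cong refl arg_cong2[where f = "(*)"] prod.cong) (use assms in auto)

text \<open>The condition that the exponents sum to \<open>k\<close> gives every monomial total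
  degree \<open>k\<close>.\<close>

lemma partial_bell_scale:
  "partial_bell r k (\<lambda>i. c * x i) = c ^ k * partial_bell r k x"
proof -
  have "(\<Prod>i=1..r - k + 1. (c * x i / fact i) ^ j i) =
      c ^ k * (\<Prod>i=1..r - k + 1. (x i / fact i) ^ j i)"
    if "(\<Sum>i=1..r - k + 1. j i) = k" for j :: "nat \<Rightarrow> nat"
    using that
    by (simp add: power_mult_distrib power_divide prod.distrib prod_dividef power_sum[symmetric])
  then show ?thesis
    unfolding partial_bell_def sum_distrib_left by (intro sum.cong) auto
qed

text \<open>\<open>F^k - G^k\<close> is \<open>F - G\<close> times a sum of products of
  \<open>k - 1\<close> factors, each divisible by \<open>fps_X\<close>. Hence it is divisible by
  \<open>fps_X\<close> to the power \<open>(r - k + 2) + (k - 1) = r + 1\<close>. This justifies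
  cutting a series off after the \<open>r - k + 1\<close> arguments of
  \<open>B_{r,k}\<close>.\<close>

lemma fps_nth_power_cutoff:
  fixes F G :: "'a :: comm_ring_1 fps"
  assumes "fps_X dvd F" "fps_X dvd G" "fps_X ^ (r - k + 1) * fps_X dvd F - G" "k \<le> r" "k \<ge> 1"
  shows "(F ^ k) $ r = (G ^ k) $ r"
proof -
  have "fps_X ^ (k - 1) dvd (\<Sum>i<k. G ^ (k - Suc i) * F ^ i)"
  proof (rule dvd_sum)
    fix i assume "i \<in> {..<k}"
    then have "fps_X ^ (k - 1) = fps_X ^ (k - Suc i) * (fps_X ^ i :: 'a fps)"
      by (simp add: power_add[symmetric])
    then show "fps_X ^ (k - 1) dvd G ^ (k - Suc i) * F ^ i"
      using assms(1,2) by (simp only: mult_dvd_mono dvd_power_same)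
  qed
  then have "fps_X ^ (r - k + 1) * fps_X * fps_X ^ (k - 1) dvd F ^ k - G ^ k"
    unfolding power_diff_sumr2 using assms(3) by (rule mult_dvd_mono[rotated])
  moreover have "fps_X ^ (r - k + 1) * fps_X * fps_X ^ (k - 1) = (fps_X ^ Suc r :: 'a fps)"
    using assms(4,5) by (simp flip: power_add power_Suc power_Suc2)
  ultimately obtain H where "F ^ k - G ^ k = fps_X ^ Suc r * H"
    by (metis dvdE)
  then have "(F ^ k - G ^ k) $ r = 0"
    by (simp add: fps_X_power_mult_nth del: power_Suc)
  then show ?thesis by simp
qed

text \<open>After the cutoff the base is the finite sum \<open>?P\<close>, to which the multinomial
  theorem applies. That theorem produces the condition on the sum of the \<open>j i\<close>; reading
  off coefficient \<open>r\<close> produces the condition on the sum of the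
  \<open>i * j i\<close>.\<close>

lemma partial_bell_conv_fps_power:
  assumes "1 \<le> k" "k \<le> r"
  shows "partial_bell r k x =
    fact r / fact k * (Abs_fps (\<lambda>m. if m = 0 then 0 else x m / fact m) ^ k) $ r"
proof -
  let ?F = "Abs_fps (\<lambda>m. if m = 0 then 0 else x m / fact m)"
  let ?N = "r - k + 1"
  let ?P = "\<Sum>i=1..?N. fps_const (x i / fact i) * fps_X ^ i"
  have P_nth: "(\<Sum>i=1..N. fps_const (x i / fact i) * fps_X ^ i) $ m =
      (if m \<in> {1..N} then x m / fact m else 0)" for m N
    by (simp add: fps_sum_nth if_distrib cong: if_cong)
  have X_dvd: "fps_X ^ m dvd G" if "\<And>i. i < m \<Longrightarrow> G $ i = 0" for m and G :: "real fps"
    using that by (metis dvd_def fps_shift_times_fps_X_power' fps_shift_times_fps_X_power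
        mult.commute subdegree_geI dvd_0_right)
  have "(?F ^ k) $ r = (?P ^ k) $ r"
  proof (rule fps_nth_power_cutoff)
    show "fps_X dvd ?F" "fps_X dvd ?P"
      using X_dvd[of 1 ?F] X_dvd[of 1 ?P] P_nth by auto
    have "fps_X ^ (?N + 1) dvd ?F - ?P"
      by (rule X_dvd) (simp only: fps_sub_nth P_nth, auto)
    then show "fps_X ^ ?N * fps_X dvd ?F - ?P"
      by (simp add: mult.commute)
  qed (use assms in auto)
  also have "?P ^ k = fps_const (fact k) * (fps_const (1 / fact k) * ?P ^ k)"
    by (simp add: mult.assoc[symmetric])
  also have "fps_const (1 / fact k) * ?P ^ k =
      (\<Sum>j | (\<forall>i. i \<notin> {1..?N} \<longrightarrow> j i = 0) \<and> sum j {1..?N} = k.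
        fps_const ((\<Prod>i=1..?N. (x i / fact i) ^ j i) / (\<Prod>i=1..?N. fact (j i)))
          * fps_X ^ (\<Sum>i=1..?N. i * j i))"
    unfolding fps_multinomial[OF finite_atLeastAtMost]
  proof (rule sum.cong[OF refl])
    fix j :: "nat \<Rightarrow> nat"
    have "(\<Prod>i=1..?N. fps_const (1 / fact (j i)) * (fps_const (x i / fact i) * fps_X ^ i) ^ j i) =
        (\<Prod>i=1..?N. fps_const ((x i / fact i) ^ j i / fact (j i)) * fps_X ^ (i * j i))"
      by (rule prod.cong[OF refl])
        (simp add: power_mult_distrib power_mult mult.assoc[symmetric] fps_const_power)
    also have "\<dots> = fps_const (\<Prod>i=1..?N. (x i / fact i) ^ j i / fact (j i))
        * fps_X ^ (\<Sum>i=1..?N. i * j i)"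
      by (simp only: prod.distrib fps_const_prod power_sum)
    finally show "(\<Prod>i=1..?N. fps_const (1 / fact (j i)) * (fps_const (x i / fact i) * fps_X ^ i) ^ j i) =
        fps_const ((\<Prod>i=1..?N. (x i / fact i) ^ j i) / (\<Prod>i=1..?N. fact (j i)))
          * fps_X ^ (\<Sum>i=1..?N. i * j i)"
      by (simp only: prod_dividef)
  qed
  also have "(fps_const (fact k) * \<dots>) $ r = fact k *
      (\<Sum>j | (\<forall>i. i \<notin> {1..?N} \<longrightarrow> j i = 0) \<and> sum j {1..?N} = k.
        if (\<Sum>i=1..?N. i * j i) = r
        then (\<Prod>i=1..?N. (x i / fact i) ^ j i) / (\<Prod>i=1..?N. fact (j i)) else 0)"
    unfolding fps_mult_left_const_nth fps_sum_nth fps_X_power_nth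
    by (intro arg_cong2[where f = "(*)"] sum.cong refl) auto
  also have "(\<Sum>j | (\<forall>i. i \<notin> {1..?N} \<longrightarrow> j i = 0) \<and> sum j {1..?N} = k.
        if (\<Sum>i=1..?N. i * j i) = r
        then (\<Prod>i=1..?N. (x i / fact i) ^ j i) / (\<Prod>i=1..?N. fact (j i)) else 0) =
      (\<Sum>j | (\<forall>i. i \<notin> {1..?N} \<longrightarrow> j i = 0) \<and> sum j {1..?N} = k \<and> (\<Sum>i=1..?N. i * j i) = r.
        (\<Prod>i=1..?N. (x i / fact i) ^ j i) / (\<Prod>i=1..?N. fact (j i)))"
    by (subst sum.inter_filter[OF finite_compositions[OF finite_atLeastAtMost], symmetric])
      (simp only: mem_Collect_eq conj_assoc)
  also have "\<dots> = partial_bell r k x / fact r"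
    unfolding partial_bell_def sum_divide_distrib by (rule sum.cong[OF refl]) simp
  finally show ?thesis by simp
qed

text \<open>The coefficient of \<open>fps_ln 1\<close> at \<open>k \<ge> 1\<close> is
  \<open>(-1)^(k-1) / k\<close>, and the \<open>k!\<close> that turns the power into a Bell
  polynomial leaves \<open>(k-1)!\<close>. The term \<open>k = 0\<close> drops out because
  \<open>fps_ln 1\<close> has no constant term.\<close>

lemma fps_nth_ln_compose:
  assumes "r \<ge> 1"
  shows "fact r * (fps_ln 1 oo Abs_fps (\<lambda>m. if m = 0 then 0 else x m / fact m)) $ r =
    (\<Sum>k=1..r. (-1) ^ (k - 1) * fact (k - 1) * partial_bell r k x)"
proof -
  let ?F = "Abs_fps (\<lambda>m. if m = 0 then 0 else x m / fact m)"
  have "fact r * (fps_ln 1 oo ?F) $ r = (\<Sum>k=1..r. fact r * (fps_ln 1 $ k * (?F ^ k) $ r))"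
    unfolding fps_compose_nth sum_distrib_left
    by (rule sum.mono_neutral_right) (auto simp: not_le)
  also have "\<dots> = (\<Sum>k=1..r. (-1) ^ (k - 1) * fact (k - 1) * partial_bell r k x)"
  proof (rule sum.cong[OF refl])
    fix k assume "k \<in> {1..r}"
    then show "fact r * (fps_ln 1 $ k * (?F ^ k) $ r) =
        (-1) ^ (k - 1) * fact (k - 1) * partial_bell r k x"
      by (simp add: partial_bell_conv_fps_power fps_ln_nth fact_reduce[of k] field_simps)
  qed
  finally show ?thesis .
qed

section \<open>Higher derivatives of a logarithm at 0\<close>

lemma has_fps_expansion_imp_higher_deriv_0:
  fixes f :: "'a :: {banach, real_normed_field} \<Rightarrow> 'a"
  assumes "f has_fps_expansion F"
  shows "(deriv ^^ n) f 0 = fact n * F $ n"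
  using assms
proof (induction n arbitrary: f F)
  case 0
  then show ?case
    by (auto simp: has_fps_expansion_def eval_fps_at_0 dest: eventually_nhds_x_imp_x)
next
  case (Suc n)
  from Suc.IH[OF has_fps_expansion_deriv[OF Suc.prems]] show ?case
    by (simp add: funpow_Suc_right algebra_simps del: funpow.simps)
qed

text \<open>One differentiation removes the logarithm: \<open>c * ln (f t)\<close> has derivative
  \<open>c * f' / f\<close>, with expansion \<open>c * F' / F\<close>. Formally,
  \<open>F' / F\<close> is also the derivative of \<open>ln (1 + U)\<close> with
  \<open>U = F - 1\<close>, so the coefficients can be read off from the composed series.\<close>

lemma higher_deriv_ln_0:
  fixes f :: "real \<Rightarrow> real"
  assumes F: "f has_fps_expansion F" and F0: "F $ 0 = 1" and r: "r \<ge> 1"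
  shows "(deriv ^^ r) (\<lambda>t. c * ln (f t)) 0 =
    c * (\<Sum>k=1..r. (-1) ^ (k - 1) * fact (k - 1) * partial_bell r k (\<lambda>i. (deriv ^^ i) f 0))"
proof -
  \<comment> \<open>This is \<open>F - 1\<close>, written in the shape that
    \<open>fps_nth_ln_compose\<close> expects.\<close>
  define U where "U = Abs_fps (\<lambda>m. if m = 0 then 0 else (deriv ^^ m) f 0 / fact m)"
  have U: "F = 1 + U"
    by (rule fps_ext) (simp add: U_def F0 has_fps_expansion_imp_higher_deriv_0[OF F])
  have U0: "U $ 0 = 0" by (simp add: U_def)
  have deriv_U: "fps_deriv (fps_ln 1 oo U) = fps_deriv F / F"
  proof -
    have "fps_deriv (fps_ln 1 oo U) = (inverse (1 + fps_X) oo U) * fps_deriv U"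
      by (simp add: fps_compose_deriv[OF U0] fps_ln_deriv)
    also have "inverse (1 + fps_X) oo U = inverse (1 + U)"
      using U0 by (simp add: fps_inverse_compose fps_compose_add_distrib)
    finally show ?thesis
      using F0 by (simp add: U fps_divide_unit mult.commute)
  qed
  have f0: "f 0 = 1"
    using has_fps_expansion_imp_higher_deriv_0[OF F, of 0] F0 by simp
  have "isCont f 0"
    by (rule has_fps_expansion_imp_continuous[OF F])
  then have "(f \<longlongrightarrow> f 0) (nhds 0)"
    by (simp only: isCont_def tendsto_at_iff_tendsto_nhds)
  then have pos: "\<forall>\<^sub>F t in nhds 0. f t > 0"
    by (rule order_tendstoD) (simp add: f0)
  have "\<forall>\<^sub>F t in nhds 0. t \<in> eball 0 (fps_conv_radius F)"
    using F by (intro eventually_nhds_in_open) (auto simp: has_fps_expansion_def zero_ereal_def)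
  moreover have "\<forall>\<^sub>F t in nhds 0. \<forall>\<^sub>F u in nhds t. eval_fps F u = f u"
    using F by (simp add: has_fps_expansion_def eventually_eventually)
  \<comment> \<open>Further derivatives follow, so the first one has to be known on a neighbourhood
    of 0. For \<open>t\<close> near 0, \<open>f\<close> agrees with \<open>eval_fps F\<close> around
    \<open>t\<close>, which makes it differentiable there.\<close>
  ultimately have ln': "\<forall>\<^sub>F t in nhds 0. deriv (\<lambda>t. c * ln (f t)) t = c * (deriv f t / f t)"
    using pos
  proof eventually_elim
    case (elim t)
    have "(eval_fps F has_field_derivative eval_fps (fps_deriv F) t) (at t)"
      using elim by (intro has_field_derivative_eval_fps) auto
    then have "(f has_field_derivative eval_fps (fps_deriv F) t) (at t)"
      using DERIV_cong_ev[OF refl elim(2) refl] by blast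
    then have "(f has_field_derivative deriv f t) (at t)"
      by (simp add: DERIV_imp_deriv)
    then show ?case
      using elim(3) by (intro DERIV_imp_deriv) (auto intro!: derivative_eq_intros)
  qed
  have "(\<lambda>t. c * (deriv f t / f t)) has_fps_expansion fps_const c * (fps_deriv F / F)"
    using F0 by (intro has_fps_expansion_cmult_left has_fps_expansion_divide'
        has_fps_expansion_deriv F) auto
  note expansion = has_fps_expansion_imp_higher_deriv_0[OF this]
  obtain r' where r': "r = Suc r'" using r by (cases r) auto
  have "(deriv ^^ r) (\<lambda>t. c * ln (f t)) 0 = (deriv ^^ r') (deriv (\<lambda>t. c * ln (f t))) 0"
    by (simp add: r' funpow_Suc_right del: funpow.simps)
  also have "\<dots> = (deriv ^^ r') (\<lambda>t. c * (deriv f t / f t)) 0"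
    by (rule higher_deriv_cong_ev[OF ln' refl])
  also have "\<dots> = fact r' * (c * fps_deriv (fps_ln 1 oo U) $ r')"
    by (simp only: expansion deriv_U fps_mult_left_const_nth)
  \<comment> \<open>Coefficient \<open>r'\<close> of the formal derivative is \<open>r\<close> times
    coefficient \<open>r\<close>, and \<open>r * fact r' = fact r\<close>.\<close>
  also have "\<dots> = c * (fact r * (fps_ln 1 oo U) $ r)"
    by (simp add: r' algebra_simps)
  finally show ?thesis
    unfolding U_def fps_nth_ln_compose[OF r] .
qed

section \<open>Generating functions of the distribution\<close>

lemma bisnomial_mass_gf:
  "(\<Sum>k=0..s * n. bisnomial_mass s n p q k * z ^ k) = (\<Sum>l=0..s. p ^ l * q ^ (s - l) * z ^ l) ^ n"
proof -
  let ?Y = "{1..n} \<rightarrow>\<^sub>E {0..s}"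
  have sum_le: "(\<Sum>i=1..n. y i) \<le> s * n" if "y \<in> ?Y" for y
  proof -
    have "(\<Sum>i=1..n. y i) \<le> (\<Sum>i=1..n. s)"
      using that by (intro sum_mono) (auto dest: PiE_mem)
    then show ?thesis by (simp add: mult.commute)
  qed
  have "(\<Sum>l=0..s. p ^ l * q ^ (s - l) * z ^ l) ^ n =
      (\<Prod>i\<in>{1..n}. \<Sum>l\<in>{0..s}. p ^ l * q ^ (s - l) * z ^ l)"
    by simp
  \<comment> \<open>Multiplying out picks an exponent \<open>y i\<close> from each of the
    \<open>n\<close> factors; the choices are then grouped by their total \<open>k\<close>.\<close>
  also have "\<dots> = (\<Sum>y\<in>?Y. \<Prod>i=1..n. p ^ y i * q ^ (s - y i) * z ^ y i)"
    by (rule prod_sum_PiE) auto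
  also have "\<dots> = (\<Sum>k=0..s * n. \<Sum>y\<in>{y \<in> ?Y. (\<Sum>i=1..n. y i) = k}.
      \<Prod>i=1..n. p ^ y i * q ^ (s - y i) * z ^ y i)"
    using sum_le by (intro sum.group[symmetric]) (auto intro: finite_PiE)
  also have "\<dots> = (\<Sum>k=0..s * n. bisnomial_mass s n p q k * z ^ k)"
  proof (rule sum.cong[OF refl])
    fix k
    have "(\<Prod>i=1..n. p ^ y i * q ^ (s - y i) * z ^ y i) = p ^ k * q ^ (s * n - k) * z ^ k"
      if y: "y \<in> ?Y" "(\<Sum>i=1..n. y i) = k" for y
    proof -
      \<comment> \<open>No subtraction truncates here, since \<open>y i \<le> s\<close> for every
        \<open>i\<close>.\<close>
      have "(\<Sum>i=1..n. s - y i) = (\<Sum>i=1..n. s) - (\<Sum>i=1..n. y i)"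
        using y(1) by (intro sum_subtractf_nat) (auto dest: PiE_mem)
      then have "(\<Sum>i=1..n. s - y i) = s * n - k"
        using y(2) by (simp add: mult.commute)
      then show ?thesis
        using y(2) by (simp add: prod.distrib power_sum[symmetric])
    qed
    then show "(\<Sum>y\<in>{y \<in> ?Y. (\<Sum>i=1..n. y i) = k}.
        \<Prod>i=1..n. p ^ y i * q ^ (s - y i) * z ^ y i) = bisnomial_mass s n p q k * z ^ k"
      by (simp add: bisnomial_mass_def bisnomial_def)
  qed
  finally show ?thesis ..
qed

text \<open>The mass vanishes beyond \<open>s * n\<close>, so the integral is a finite sum: the
  generating function at \<open>z = exp t\<close>.\<close>

lemma bisnomial_mgf:
  assumes "bisnomial_distributed M X s n p q" "0 \<le> p" "0 \<le> q"
  shows "(\<integral>\<omega>. exp (t * real (X \<omega>)) \<partial>M) =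
    (\<Sum>l=0..s. p ^ l * q ^ (s - l) * exp (real l * t)) ^ n"
proof -
  have mass_nonzero: "k \<le> s * n" if "bisnomial_mass s n p q k \<noteq> 0" for k
    using that bisnomial_eq_0[of s n k] by (force simp: bisnomial_mass_def)
  have exp_power: "exp (t * real k) = exp t ^ k" for k
    using exp_of_nat_mult[of k t] by (simp add: mult.commute)
  have "(\<integral>\<omega>. exp (t * real (X \<omega>)) \<partial>M) =
      (\<integral>k. bisnomial_mass s n p q k * exp (t * real k) \<partial>count_space UNIV)"
    using assms
    by (intro distributed_integral[symmetric]) (auto simp: bisnomial_distributed_def bisnomial_mass_def)
  also have "\<dots> = (\<Sum>k | k \<in> UNIV \<and> bisnomial_mass s n p q k * exp (t * real k) \<noteq> 0.
      bisnomial_mass s n p q k * exp (t * real k))"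
    by (rule lebesgue_integral_count_space_finite_support, rule finite_subset[of _ "{0..s * n}"])
      (use mass_nonzero in auto)
  also have "\<dots> = (\<Sum>k=0..s * n. bisnomial_mass s n p q k * exp t ^ k)"
    unfolding exp_power
    by (rule sum.mono_neutral_left) (use mass_nonzero in auto)
  also have "\<dots> = (\<Sum>l=0..s. p ^ l * q ^ (s - l) * exp t ^ l) ^ n"
    by (rule bisnomial_mass_gf)
  finally show ?thesis
    by (simp add: exp_power[symmetric] mult.commute)
qed

section \<open>Cumulants of the distribution\<close>

lemma bisnomial_cumulant:
  assumes p: "0 < p" and q: "0 < q" and total: "(\<Sum>k=0..s. p ^ k * q ^ (s - k)) = 1"
    and X: "bisnomial_distributed M X s n p q" and r: "r \<ge> 1"
  shows "cumulant M (\<lambda>\<omega>. real (X \<omega>)) r =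
    real n * (\<Sum>k=1..r. (-1) ^ (k - 1) * fact (k - 1) *
      partial_bell r k (\<lambda>i. \<Sum>l=1..s. real l ^ i * p ^ l * q ^ (s - l)))"
proof -
  define \<phi> where "\<phi> t = (\<Sum>l=0..s. p ^ l * q ^ (s - l) * exp (real l * t))" for t
  have \<phi>_pos: "\<phi> t > 0" for t
    unfolding \<phi>_def using p q by (intro sum_pos) auto
  have \<phi>: "\<phi> has_fps_expansion (\<Sum>l=0..s. fps_const (p ^ l * q ^ (s - l)) * fps_exp (real l))"
    unfolding \<phi>_def[abs_def] by (intro fps_expansion_intros)
  have cgf: "cumulant_gf M (\<lambda>\<omega>. real (X \<omega>)) = (\<lambda>t. real n * ln (\<phi> t))"
    using p q \<phi>_pos
    by (intro ext) (simp add: cumulant_gf_def bisnomial_mgf[OF X] \<phi>_def[symmetric] ln_realpow)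
  \<comment> \<open>For \<open>i \<ge> 1\<close> the summand \<open>l = 0\<close> vanishes because
    \<open>0 ^ i = 0\<close>. At \<open>i = 0\<close> it would contribute \<open>q ^ s\<close>, but
    Bell polynomials read their arguments from index 1 on.\<close>
  have deriv_\<phi>: "(deriv ^^ i) \<phi> 0 = (\<Sum>l=1..s. real l ^ i * p ^ l * q ^ (s - l))" if "i \<ge> 1" for i
  proof -
    have "(deriv ^^ i) \<phi> 0 = (\<Sum>l=0..s. real l ^ i * p ^ l * q ^ (s - l))"
      by (simp add: has_fps_expansion_imp_higher_deriv_0[OF \<phi>] fps_sum_nth sum_distrib_left
          algebra_simps)
    also have "\<dots> = (\<Sum>l=1..s. real l ^ i * p ^ l * q ^ (s - l))"
      using that by (intro sum.mono_neutral_right) (auto simp: not_le)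
    finally show ?thesis .
  qed
  have "cumulant M (\<lambda>\<omega>. real (X \<omega>)) r = real n * (\<Sum>k=1..r. (-1) ^ (k - 1) * fact (k - 1) *
      partial_bell r k (\<lambda>i. (deriv ^^ i) \<phi> 0))"
    unfolding cumulant_def cgf
    \<comment> \<open>The constant coefficient is 1 by the normalisation
      \<open>total\<close>.\<close>
    by (rule higher_deriv_ln_0[OF \<phi> _ r]) (simp add: fps_sum_nth total)
  then show ?thesis
    using partial_bell_cong[OF deriv_\<phi>] by simp
qed

theorem theorem4p3:
  fixes s n r :: nat and p q :: real and M :: "'a measure" and X :: "'a \<Rightarrow> nat"
    and x :: "nat \<Rightarrow> real"
  assumes "s \<ge> 1" and "n \<ge> 1"
    and "0 < p" and "p < 1" and "0 < q" and "q < 1"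
    and "(\<Sum>k=0..s. p ^ k * q ^ (s - k)) = 1"
    and "prob_space M"
    and "bisnomial_distributed M X s n p q"
    and "\<And>i. i \<ge> 1 \<Longrightarrow> x i = (\<Sum>l=1..s. real l ^ i * p ^ l * q ^ (s - l))"
    and "r \<ge> 1"
  shows "(p \<noteq> q \<longrightarrow>
            cumulant M (\<lambda>\<omega>. real (X \<omega>)) r =
              real n * (\<Sum>k=1..r. (-1) ^ (k - 1) * fact (k - 1) * partial_bell r k x)) \<and>
         (p = q \<longrightarrow>
            cumulant M (\<lambda>\<omega>. real (X \<omega>)) r =
              real n * (\<Sum>k=1..r. (-1) ^ (k - 1) * fact (k - 1) * p ^ (k * s) *
                partial_bell r k (\<lambda>i. \<Sum>l=1..s. real l ^ i)))"
proof -
  have x: "partial_bell r k (\<lambda>i. \<Sum>l=1..s. real l ^ i * p ^ l * q ^ (s - l)) = partial_bell r k x" for k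
    by (rule partial_bell_cong) (simp add: assms(10))
  note cumulant = bisnomial_cumulant[OF assms(3,5,7,9,11), unfolded x]
  have "partial_bell r k x = p ^ (k * s) * partial_bell r k (\<lambda>i. \<Sum>l=1..s. real l ^ i)"
    if "p = q" for k
  proof -
    \<comment> \<open>With \<open>q = p\<close> the weight \<open>p ^ l * p ^ (s - l)\<close> equals
      \<open>p ^ s\<close> for every \<open>l \<le> s\<close>.\<close>
    have "(\<Sum>l=1..s. real l ^ i * p ^ l * q ^ (s - l)) = p ^ s * (\<Sum>l=1..s. real l ^ i)" for i
      unfolding sum_distrib_left
      by (rule sum.cong) (auto simp: that[symmetric] mult.assoc power_add[symmetric])
    then show ?thesis
      unfolding x[symmetric] by (simp add: partial_bell_scale power_mult[symmetric] mult.commute)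
  qed
  with cumulant show ?thesis
    by (auto simp only: mult.assoc)
qed

end
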